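(* Let $M>0$ and $m\in\mathbb{N}$. If $P_n(z)=a_{n,n}\prod_{k=1}^n(z-\alpha_{k,n})\in\mathbb{Z}_n^s(D,M)$, $n\in\mathbb{N}$, and $s_m:=\sum_{k=1}^n\alpha_{k,n}^m$, then $$|s_m|\le(24m+16)\sqrt{n\log n},\qquad n\ge\max(M,55).$$
   Context: $\mathbb{N}$ is the set of positive integers. $D:=\{z\in\mathbb{C}:|z|\le 1\}$ is the closed unit disk. $\mathbb{Z}_n^s(D,M)$ denotes the set of polynomials with integer coefficients, of exact degree $n$, all of whose zeros are simple and lie in $D$, and whose leading coefficient $a_{n,n}$ satisfies $|a_{n,n}|\le M$. $\log$ is the natural logarithm. *)

theory Defs
  imports "HOL-Analysis.Analysis" "HOL-Computational_Algebra.Computational_Algebra"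
begin

abbreviation closed_unit_disk :: "complex set" where
  "closed_unit_disk \<equiv> cball 0 1"

text \<open>
  The class \<open>\<int>\<^sub>n\<^sup>s(E, M)\<close>. The zero polynomial, which has degree 0 in the library, is excluded
  explicitly, so that \<open>degree p = n\<close> means exact degree also for \<open>n = 0\<close>.
\<close>

definition int_polys_simple :: "nat \<Rightarrow> complex set \<Rightarrow> real \<Rightarrow> int poly set" where
  "int_polys_simple n E M =
     {p. p \<noteq> 0 \<and> degree p = n \<and>
         (\<forall>z::complex. poly (map_poly of_int p) z = 0 \<longrightarrow>
            z \<in> E \<and> order z (map_poly of_int p) = 1) \<and>
         real_of_int \<bar>lead_coeff p\<bar> \<le> M}"

end

theory Submission
  imports "Jordan_Normal_Form.Determinant" Defs
begin

text \<open>
  The roots repel each other because \<open>P\<close> has integer coefficients, and points of the unit disk that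
  are not too close to each other must have small power sums.

  Repulsion: the resultant of \<open>P\<close> and \<open>P'\<close> is a nonzero integer, and it is
  \<open>a\<^sup>2\<^sup>n\<^sup>-\<^sup>1 \<Prod>\<^sub>k \<Prod>\<^sub>j\<^sub>\<noteq>\<^sub>k (\<alpha>\<^sub>k - \<alpha>\<^sub>j)\<close> up to sign, where \<open>a\<close> is the leading coefficient. Since
  \<open>\<bar>a\<bar> \<le> M \<le> n\<close>, taking logarithms gives
  \<open>\<Sum>\<^sub>j\<^sub>\<noteq>\<^sub>k - ln \<bar>\<alpha>\<^sub>j - \<alpha>\<^sub>k\<bar> \<le> (2n - 1) ln n\<close> (lemma \<open>root_separation_sum_le\<close>).

  Energy: for points \<open>w\<^sub>k\<close> of the open disk, expanding the logarithm gives
  \<open>\<Sum>\<^sub>j\<^sub>,\<^sub>k - ln \<bar>1 - w\<^sub>j cnj w\<^sub>k\<bar> = \<Sum>\<^sub>i \<bar>\<Sum>\<^sub>k w\<^sub>k\<^sup>i\<bar>\<^sup>2 / i\<close>. All terms on the right are nonnegative, so each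
  power sum is bounded by the energy on the left (lemma \<open>power_sum_le_logarithmic_energy\<close>).

  The two meet in the inequality \<open>\<bar>z - w\<bar> \<le> \<bar>1 - z cnj w\<bar>\<close> for \<open>z, w\<close> in the disk: with
  \<open>w\<^sub>k = \<rho> \<alpha>\<^sub>k\<close> and \<open>\<rho> < 1\<close>, the off-diagonal part of the energy is at most
  \<open>\<Sum>\<^sub>j\<^sub>\<noteq>\<^sub>k - ln \<bar>\<alpha>\<^sub>j - \<alpha>\<^sub>k\<bar> - n (n - 1) ln \<rho>\<close> and the diagonal part at most \<open>- n ln (1 - \<rho>\<^sup>2)\<close>. The choice
  \<open>\<rho>\<^sup>2 = 1 - 1/(mn)\<close> makes both errors \<open>O(m n ln n)\<close> while \<open>\<rho>\<^sup>2\<^sup>m\<close> stays above \<open>1/2\<close>. The outcome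
  (lemma \<open>power_sum_sq_le\<close>) is \<open>\<bar>s\<^sub>m\<bar>\<^sup>2 \<le> 2 m (m + 3) n ln n\<close>, which is stronger than the stated bound.
\<close>

section \<open>Integrality of the resultant\<close>

text \<open>
  A vector in the kernel of the transposed matrix is the coefficient vector of a polynomial of degree
  below \<open>n\<close> with \<open>n\<close> distinct roots.
\<close>

lemma det_vandermonde_nonzero:
  fixes \<alpha> :: "nat \<Rightarrow> 'a::field"
  assumes inj: "inj_on \<alpha> {..<n}"
  shows "Determinant.det (Matrix.mat n n (\<lambda>(j, k). \<alpha> k ^ j)) \<noteq> 0"
proof
  define V where "V = Matrix.mat n n (\<lambda>(j, k). \<alpha> k ^ j)"
  have V: "V \<in> carrier_mat n n" by (simp add: V_def)
  assume "Determinant.det (Matrix.mat n n (\<lambda>(j, k). \<alpha> k ^ j)) = 0"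
  hence "Determinant.det (transpose_mat V) = 0"
    using Determinant.det_transpose[OF V] by (simp add: V_def)
  then obtain v where v: "v \<in> carrier_vec n" "v \<noteq> 0\<^sub>v n" "transpose_mat V *\<^sub>v v = 0\<^sub>v n"
    using det_0_iff_vec_prod_zero[of "transpose_mat V" n] V by auto
  define p where "p = (\<Sum>j<n. monom (vec_index v j) j)"
  have coeff_p: "coeff p j = (if j < n then vec_index v j else 0)" for j
    by (simp add: p_def coeff_sum)
  have root: "poly p (\<alpha> k) = 0" if "k < n" for k
  proof -
    have "vec_index (transpose_mat V *\<^sub>v v) k = (\<Sum>j<n. \<alpha> k ^ j * vec_index v j)"
      using that v(1) by (simp add: V_def scalar_prod_def atLeast0LessThan)
    thus ?thesis using that v(3) by (simp add: p_def poly_sum poly_monom mult.commute)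
  qed
  have "p = 0"
  proof (rule ccontr)
    assume nz: "p \<noteq> 0"
    have "coeff p (degree p) \<noteq> 0" using nz by simp
    hence deg: "degree p < n" using coeff_p by metis
    have "n = card (\<alpha> ` {..<n})" using inj by (simp add: card_image)
    also have "\<dots> \<le> card {x. poly p x = 0}"
      using root nz by (intro card_mono poly_roots_finite) auto
    also have "\<dots> \<le> degree p" using nz by (rule card_poly_roots_bound)
    finally show False using deg by simp
  qed
  hence "vec_index v j = 0" if "j < n" for j using coeff_p[of j] that by simp
  hence "v = 0\<^sub>v n" using v(1) by (intro eq_vecI) auto
  with v(2) show False by simp
qed

lemma poly_eq_sum_lessThan:
  fixes p :: "'a::comm_semiring_1 poly"
  assumes "degree p < N"
  shows "poly p x = (\<Sum>j<N. coeff p j * x ^ j)"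
  unfolding poly_altdef using assms
  by (intro sum.mono_neutral_left) (auto simp: coeff_eq_0)

text \<open>
  The integer is the determinant of the Sylvester-type matrix \<open>S\<close> whose rows are the coefficients of
  \<open>Q, x Q, \<dots>, x\<^sup>n\<^sup>-\<^sup>1 Q, P, x P, \<dots>, x\<^sup>d\<^sup>-\<^sup>1 P\<close>. Let the matrix \<open>E\<close> send the coefficients of a polynomial to its values
  at the \<open>n\<close> roots, followed by its coefficients of degree \<open>n, \<dots>, n + d - 1\<close>. Then \<open>det E\<close> is the
  Vandermonde determinant \<open>det V\<close>. In \<open>S E\<close> the multiples of \<open>P\<close> vanish at the roots, so \<open>S E\<close> is block
  triangular, with blocks \<open>V\<close> times the diagonal matrix of the \<open>Q(\<alpha>\<^sub>k)\<close> and a triangular matrix with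
  diagonal \<open>a\<close>. Cancelling \<open>det V\<close> leaves \<open>det S = a\<^sup>d \<Prod>\<^sub>k Q(\<alpha>\<^sub>k)\<close>. The exponent \<open>d\<close> is what matters:
  merely clearing the denominators of a symmetric function of the roots would cost a power of \<open>a\<close> that
  is quadratic in \<open>n\<close> when \<open>Q = P'\<close>.
\<close>

lemma resultant_over_roots_integral:
  fixes P Q :: "int poly" and \<alpha> :: "nat \<Rightarrow> 'a::field"
  assumes P: "map_poly of_int P = smult (of_int a) (\<Prod>k<n. [:- \<alpha> k, 1:])"
    and degP: "degree P \<le> n"
    and inj: "inj_on \<alpha> {..<n}" and degQ: "degree Q \<le> d"
  shows "\<exists>N::int. of_int a ^ d * (\<Prod>k<n. poly (map_poly of_int Q) (\<alpha> k)) = of_int N"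
proof -
  define p q where "p = map_poly (of_int :: int \<Rightarrow> 'a) P" and "q = map_poly (of_int :: int \<Rightarrow> 'a) Q"
  have coeff_p: "coeff p i = of_int (coeff P i)" and coeff_q: "coeff q i = of_int (coeff Q i)" for i
    by (simp_all add: p_def q_def coeff_map_poly)
  have degp: "degree p \<le> n" and degq: "degree q \<le> d"
    using degP degQ coeff_p coeff_q by (auto intro!: degree_le simp: coeff_eq_0)
  have lead_p: "coeff p n = of_int a"
  proof -
    have "degree (\<Prod>k<n. [:- \<alpha> k, 1:]) = n" by (subst degree_prod_eq_sum_degree) auto
    moreover have "lead_coeff (\<Prod>k<n. [:- \<alpha> k, 1:]) = 1" by (simp add: lead_coeff_prod)
    ultimately show ?thesis by (simp add: p_def P)
  qed
  have root_p: "poly p (\<alpha> k) = 0" if "k < n" for k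
    using that by (auto simp add: p_def P poly_prod)
  define N where "N = n + d"
  define R where "R i = (if i < n then monom 1 i * q else monom 1 (i - n) * p)" for i
  have degR: "degree (R i) < N" if "i < N" for i
  proof (cases "i < n")
    case True
    have "degree (R i) \<le> i + degree q"
      using True degree_mult_le[of "monom 1 i" q] by (simp add: R_def degree_monom_eq)
    thus ?thesis using True degq by (simp add: N_def)
  next
    case False
    have "degree (R i) \<le> (i - n) + degree p"
      using False degree_mult_le[of "monom 1 (i - n)" p] by (simp add: R_def degree_monom_eq)
    thus ?thesis using False degp that by (simp add: N_def)
  qed
  \<comment> \<open>The multiples of \<open>Q\<close> come first, which makes the vanishing block the lower left one.\<close>
  define S where "S = Matrix.mat N N (\<lambda>(i, j).
    coeff (if i < n then monom 1 i * Q else monom 1 (i - n) * P) j)"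
  define E where "E = Matrix.mat N N (\<lambda>(j, k). if k < n then \<alpha> k ^ j else if j = k then 1 else 0)"
  define V where "V = Matrix.mat n n (\<lambda>(j, k). \<alpha> k ^ j)"
  define T where "T = Matrix.mat d d (\<lambda>(i, l). coeff (monom 1 i * p) (n + l))"
  define D where "D = mat_diag n (\<lambda>k. poly q (\<alpha> k))"
  define B where "B = Matrix.mat n d (\<lambda>(i, l). coeff (R i) (n + l))"
  have carr: "V \<in> carrier_mat n n" "T \<in> carrier_mat d d" "D \<in> carrier_mat n n"
    "B \<in> carrier_mat n d" "map_mat of_int S \<in> carrier_mat N N" "E \<in> carrier_mat N N"
    by (simp_all add: V_def T_def D_def B_def S_def E_def mat_diag_def)
  have S_entry: "map_mat (of_int :: int \<Rightarrow> 'a) S $$ (i, j) = coeff (R i) j" if "i < N" "j < N" for i j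
    using that by (simp add: S_def R_def coeff_monom_mult coeff_p coeff_q)
  have prod_entry: "(map_mat of_int S * E) $$ (i, k)
      = (if k < n then poly (R i) (\<alpha> k) else coeff (R i) k)" if "i < N" "k < N" for i k
  proof -
    have "(map_mat of_int S * E) $$ (i, k) = (\<Sum>j<N. coeff (R i) j * E $$ (j, k))"
      using that carr S_entry[OF that(1)] by (auto simp: scalar_prod_def atLeast0LessThan intro!: sum.cong)
    also have "\<dots> = (if k < n then poly (R i) (\<alpha> k) else coeff (R i) k)"
    proof (cases "k < n")
      case True
      thus ?thesis using that by (simp add: E_def poly_eq_sum_lessThan[OF degR])
    next
      case False
      have "(\<Sum>j<N. coeff (R i) j * E $$ (j, k)) = (\<Sum>j<N. if j = k then coeff (R i) k else 0)"
        using False that by (intro sum.cong) (auto simp: E_def)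
      thus ?thesis using False that by simp
    qed
    finally show ?thesis .
  qed
  have "map_mat of_int S * E = four_block_mat (V * D) B (0\<^sub>m d n) T"
  proof (rule eq_matI, goal_cases)
    case (1 i k)
    hence ik: "i < N" "k < N" using carr by (auto simp: N_def)
    have VD: "(V * D) $$ (i, k) = \<alpha> k ^ i * poly q (\<alpha> k)" if "i < n" "k < n"
      using that unfolding D_def mat_diag_mult_right[OF carr(1)] by (simp add: V_def)
    show ?case
      unfolding prod_entry[OF ik] using ik carr VD
      by (auto simp: N_def R_def poly_monom root_p B_def T_def coeff_monom_mult)
  qed (use carr in \<open>auto simp: N_def\<close>)
  hence "Determinant.det (map_mat of_int S) * Determinant.det E = Determinant.det V * Determinant.det D * Determinant.det T"
    using carr det_mult[of "map_mat of_int S" N E] det_mult[of V n D]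
      det_four_block_mat_lower_left_zero[of "V * D" n B d "0\<^sub>m d n" T] by simp
  moreover have "Determinant.det E = Determinant.det V"
  proof -
    define E3 where "E3 = Matrix.mat d n (\<lambda>(j, k). \<alpha> k ^ (n + j))"
    have "E = four_block_mat V (0\<^sub>m n d) E3 (1\<^sub>m d)"
      by (rule eq_matI) (auto simp: E_def V_def E3_def N_def)
    thus ?thesis
      using det_four_block_mat_upper_right_zero[of V n "0\<^sub>m n d" d E3 "1\<^sub>m d"] carr
      by (simp add: E3_def)
  qed
  moreover have "Determinant.det T = of_int a ^ d"
  proof -
    have "Determinant.det T = prod_list (diag_mat T)"
      using carr degp by (intro det_lower_triangular[where n = d]) (auto simp: T_def coeff_monom_mult coeff_eq_0)
    thus ?thesis by (simp add: prod_list_diag_prod T_def coeff_monom_mult lead_p)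
  qed
  moreover have "Determinant.det D = (\<Prod>k<n. poly q (\<alpha> k))"
  proof -
    have "Determinant.det D = prod_list (diag_mat D)"
      using carr by (intro det_lower_triangular[where n = n]) (auto simp: D_def mat_diag_def)
    thus ?thesis by (simp add: prod_list_diag_prod D_def mat_diag_def atLeast0LessThan)
  qed
  moreover have "Determinant.det V \<noteq> 0"
    unfolding V_def by (rule det_vandermonde_nonzero[OF inj])
  ultimately have "of_int a ^ d * (\<Prod>k<n. poly q (\<alpha> k)) = Determinant.det (map_mat of_int S)"
    by (simp add: mult_ac)
  also have "\<dots> = of_int (Determinant.det S)" by (rule of_int_hom.hom_det)
  finally show ?thesis unfolding q_def by blast
qed

section \<open>Repulsion of the roots of an integer polynomial\<close>

lemma poly_pderiv_prod_linear_root: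
  fixes \<alpha> :: "'b \<Rightarrow> 'a::idom"
  assumes "finite I" "k \<in> I"
  shows "poly (pderiv (\<Prod>j\<in>I. [:- \<alpha> j, 1:])) (\<alpha> k) = (\<Prod>j\<in>I - {k}. \<alpha> k - \<alpha> j)"
proof -
  have "(\<Prod>j\<in>I. [:- \<alpha> j, 1:]) = [:- \<alpha> k, 1:] * (\<Prod>j\<in>I - {k}. [:- \<alpha> j, 1:])"
    using assms by (simp add: prod.remove)
  thus ?thesis by (simp add: pderiv_mult pderiv_pCons poly_prod del: mult_pCons_left)
qed

text \<open>
  By \<open>P'(\<alpha>\<^sub>k) = a \<Prod>\<^sub>j\<^sub>\<noteq>\<^sub>k (\<alpha>\<^sub>k - \<alpha>\<^sub>j)\<close> the right-hand side is the absolute value of the resultant of \<open>P\<close> and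
  \<open>P'\<close>, an integer that does not vanish because the roots are distinct. It is \<open>\<bar>a\<bar>\<close> times the absolute
  value of the discriminant.
\<close>

lemma resultant_with_derivative_ge_one:
  fixes P :: "int poly" and \<alpha> :: "nat \<Rightarrow> complex"
  assumes P: "map_poly of_int P = smult (of_int a) (\<Prod>k<n. [:- \<alpha> k, 1:])"
    and a: "a \<noteq> 0" and degP: "degree P \<le> n" and inj: "inj_on \<alpha> {..<n}"
  shows "1 \<le> \<bar>real_of_int a\<bar> ^ (2 * n - 1) * (\<Prod>k<n. \<Prod>j\<in>{..<n} - {k}. cmod (\<alpha> k - \<alpha> j))"
    (is "1 \<le> ?R")
proof -
  have "degree (pderiv P) \<le> n - 1"
    using degP by (simp add: degree_pderiv)
  then obtain N :: int where
    N: "of_int a ^ (n - 1) * (\<Prod>k<n. poly (map_poly of_int (pderiv P)) (\<alpha> k)) = (of_int N :: complex)"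
    using resultant_over_roots_integral[OF P degP inj] by blast
  have deriv: "poly (map_poly of_int (pderiv P)) (\<alpha> k)
      = of_int a * (\<Prod>j\<in>{..<n} - {k}. \<alpha> k - \<alpha> j)" if "k < n" for k
  proof -
    have "map_poly of_int (pderiv P) = pderiv (map_poly complex_of_int P)"
      by (rule poly_eqI) (simp add: coeff_map_poly coeff_pderiv)
    thus ?thesis using that by (simp add: P pderiv_smult poly_pderiv_prod_linear_root)
  qed
  have power: "\<bar>real_of_int a\<bar> ^ (n - 1) * \<bar>real_of_int a\<bar> ^ n = \<bar>real_of_int a\<bar> ^ (2 * n - 1)"
    unfolding power_add[symmetric] by (rule arg_cong[of _ _ "power \<bar>real_of_int a\<bar>"]) arith
  have "cmod (of_int N) = \<bar>real_of_int a\<bar> ^ (n - 1) *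
      (\<Prod>k<n. \<bar>real_of_int a\<bar> * (\<Prod>j\<in>{..<n} - {k}. cmod (\<alpha> k - \<alpha> j)))"
    by (simp add: N[symmetric] norm_mult norm_power deriv prod_norm[symmetric])
  also have "\<dots> = ?R"
    by (simp only: prod.distrib prod_constant card_lessThan mult.assoc[symmetric] power)
  finally have R: "real_of_int \<bar>N\<bar> = ?R" by simp
  moreover have "0 < ?R"
    using a inj by (intro mult_pos_pos zero_less_power prod_pos) (auto simp: inj_on_def)
  ultimately have "0 < \<bar>N\<bar>" by linarith
  hence "1 \<le> real_of_int \<bar>N\<bar>" by linarith
  thus ?thesis unfolding R .
qed

lemma root_separation_sum_le:
  fixes P :: "int poly" and \<alpha> :: "nat \<Rightarrow> complex"
  assumes P: "map_poly of_int P = smult (of_int a) (\<Prod>k<n. [:- \<alpha> k, 1:])"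
    and a: "a \<noteq> 0" and degP: "degree P \<le> n" and inj: "inj_on \<alpha> {..<n}"
  shows "(\<Sum>k<n. \<Sum>j\<in>{..<n} - {k}. - ln (cmod (\<alpha> k - \<alpha> j))) \<le> real (2 * n - 1) * ln \<bar>real_of_int a\<bar>"
proof -
  have pos: "0 < cmod (\<alpha> k - \<alpha> j)" if "k < n" "j \<in> {..<n} - {k}" for k j
    using that inj by (auto simp: inj_on_def)
  define R where "R = (\<Prod>k<n. \<Prod>j\<in>{..<n} - {k}. cmod (\<alpha> k - \<alpha> j))"
  have "R > 0" unfolding R_def using pos by (intro prod_pos) auto
  have "ln R = (\<Sum>k<n. \<Sum>j\<in>{..<n} - {k}. ln (cmod (\<alpha> k - \<alpha> j)))"
    unfolding R_def using pos by (subst ln_prod; (intro prod_pos sum.cong ln_prod refl)?) auto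
  moreover have "0 \<le> ln (\<bar>real_of_int a\<bar> ^ (2 * n - 1) * R)"
    using resultant_with_derivative_ge_one[OF assms] by (simp add: R_def)
  moreover have "ln (\<bar>real_of_int a\<bar> ^ (2 * n - 1) * R) = real (2 * n - 1) * ln \<bar>real_of_int a\<bar> + ln R"
    using a \<open>R > 0\<close> by (simp add: ln_mult ln_realpow)
  ultimately show ?thesis by (simp add: sum_negf)
qed

section \<open>Power sums and logarithmic energy\<close>

text \<open>
  The difference of the squares of the two sides is \<open>(1 - \<bar>z\<bar>\<^sup>2) (1 - \<bar>w\<bar>\<^sup>2)\<close>; for \<open>z, w\<close> in the open
  disk this says that their pseudohyperbolic distance is at most \<open>1\<close>.
\<close>

lemma cmod_diff_le_cmod_one_minus_cnj:
  assumes "cmod z \<le> 1" "cmod w \<le> 1"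
  shows "cmod (z - w) \<le> cmod (1 - z * cnj w)"
proof (rule power2_le_imp_le)
  have lagrange: "(1 - (a * c + b * d))\<^sup>2 + (a * d - b * c)\<^sup>2 - ((a - c)\<^sup>2 + (b - d)\<^sup>2)
      = (1 - (a\<^sup>2 + b\<^sup>2)) * (1 - (c\<^sup>2 + d\<^sup>2))" for a b c d :: real
    by (simp add: power2_eq_square algebra_simps)
  have "cmod (1 - z * cnj w) ^ 2 - cmod (z - w) ^ 2
      = (1 - (Re z * Re w + Im z * Im w))\<^sup>2 + (Re z * Im w - Im z * Re w)\<^sup>2
        - ((Re z - Re w)\<^sup>2 + (Im z - Im w)\<^sup>2)"
    by (simp add: cmod_power2)
  also have "\<dots> = (1 - ((Re z)\<^sup>2 + (Im z)\<^sup>2)) * (1 - ((Re w)\<^sup>2 + (Im w)\<^sup>2))"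
    by (rule lagrange)
  also have "\<dots> = (1 - cmod z ^ 2) * (1 - cmod w ^ 2)" by (simp only: cmod_power2)
  also have "\<dots> \<ge> 0"
    using assms by (intro mult_nonneg_nonneg) (simp_all add: power_le_one)
  finally show "cmod (z - w) ^ 2 \<le> cmod (1 - z * cnj w) ^ 2" by linarith
qed (rule norm_ge_zero)


lemma ln_cmod_one_minus_sums:
  assumes "cmod z < 1"
  shows "(\<lambda>i. Re (z ^ i) / real i) sums - ln (cmod (1 - z))"
proof -
  have "(\<lambda>i. (- 1) ^ Suc i / of_nat i * (- z) ^ i) sums Ln (1 + - z)"
    by (rule Ln_series) (use assms in simp)
  hence "(\<lambda>i. - (Re ((- 1) ^ Suc i / of_nat i * (- z) ^ i))) sums - Re (Ln (1 - z))"
    by (intro sums_minus sums_Re) simp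
  moreover have nz: "1 - z \<noteq> 0" using assms by auto
  moreover have "- (Re ((- 1) ^ Suc i / of_nat i * (- z) ^ i)) = Re (z ^ i) / real i" for i
  proof -
    have "(- 1) ^ i * (- z) ^ i = ((- 1) * (- z)) ^ i" by (rule power_mult_distrib[symmetric])
    hence "(- 1) ^ i * (- z) ^ i = z ^ i" by simp
    hence "(- 1) ^ Suc i / of_nat i * (- z) ^ i = - (z ^ i / of_nat i)" by simp
    thus ?thesis by (simp only: uminus_complex.sel Re_divide_of_nat minus_minus)
  qed
  ultimately show ?thesis by (simp only: Re_Ln[OF nz])
qed

text \<open>
  The kernel \<open>- ln \<bar>1 - z cnj w\<bar> = \<Sum>\<^sub>i Re ((z cnj w)\<^sup>i) / i\<close> is positive definite: summed over all pairs,
  its \<open>i\<close>-th term becomes \<open>\<bar>\<Sum>\<^sub>k w\<^sub>k\<^sup>i\<bar>\<^sup>2 / i\<close>. Dropping all terms but the \<open>m\<close>-th one gives the bound.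
\<close>

lemma power_sum_le_logarithmic_energy:
  fixes w :: "'a \<Rightarrow> complex"
  assumes "finite I" and w: "\<And>k. k \<in> I \<Longrightarrow> cmod (w k) < 1" 
  shows "cmod (\<Sum>k\<in>I. w k ^ m) ^ 2 / real m
           \<le> (\<Sum>j\<in>I. \<Sum>k\<in>I. - ln (cmod (1 - w j * cnj (w k))))"
proof -
  define s where "s i = (\<Sum>k\<in>I. w k ^ i)" for i
  define L where "L = (\<Sum>j\<in>I. \<Sum>k\<in>I. - ln (cmod (1 - w j * cnj (w k))))"
  have "(\<lambda>i. \<Sum>j\<in>I. \<Sum>k\<in>I. Re ((w j * cnj (w k)) ^ i) / real i) sums L"
    unfolding L_def
  proof (intro sums_sum ln_cmod_one_minus_sums)
    fix j k assume "j \<in> I" "k \<in> I"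
    thus "cmod (w j * cnj (w k)) < 1"
      using w[of j] w[of k] mult_strict_mono[of "cmod (w j)" 1 "cmod (w k)" 1]
      by (simp add: norm_mult)
  qed
  moreover have "(\<Sum>j\<in>I. \<Sum>k\<in>I. Re ((w j * cnj (w k)) ^ i) / real i) = cmod (s i) ^ 2 / real i" for i
  proof -
    have "complex_of_real (cmod (s i) ^ 2) = s i * cnj (s i)"
      by (rule complex_norm_square)
    also have "\<dots> = (\<Sum>j\<in>I. \<Sum>k\<in>I. (w j * cnj (w k)) ^ i)"
      by (simp add: s_def sum_product power_mult_distrib)
    finally have "Re (of_real (cmod (s i) ^ 2)) = Re (\<Sum>j\<in>I. \<Sum>k\<in>I. (w j * cnj (w k)) ^ i)"
      by (rule arg_cong)
    hence "cmod (s i) ^ 2 = (\<Sum>j\<in>I. \<Sum>k\<in>I. Re ((w j * cnj (w k)) ^ i))"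
      by (simp only: Re_complex_of_real Re_sum)
    thus ?thesis by (simp add: sum_divide_distrib)
  qed
  ultimately have sums: "(\<lambda>i. cmod (s i) ^ 2 / real i) sums L" by (simp only:)
  have "(\<Sum>i\<in>{m}. cmod (s i) ^ 2 / real i) \<le> (\<Sum>i. cmod (s i) ^ 2 / real i)"
    by (intro sum_le_suminf sums_summable[OF sums]) auto
  thus ?thesis unfolding sums_unique[OF sums, symmetric] by (simp add: s_def L_def)
qed

text \<open>
  The points are contracted to \<open>\<rho> \<alpha>\<^sub>k\<close> because the energy of points on the unit circle has infinite
  diagonal terms. The contraction costs \<open>- ln \<rho>\<close> for each of the \<open>n (n - 1)\<close> off-diagonal pairs.
\<close>

lemma power_sum_le_separation:
  fixes \<alpha> :: "nat \<Rightarrow> complex" and \<rho> :: real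
  assumes disk: "\<And>k. k < n \<Longrightarrow> cmod (\<alpha> k) \<le> 1" and inj: "inj_on \<alpha> {..<n}"
    and \<rho>: "0 < \<rho>" "\<rho> < 1"
  shows "\<rho> ^ (2 * m) * cmod (\<Sum>k<n. \<alpha> k ^ m) ^ 2 / real m
    \<le> real n * - ln (1 - \<rho>\<^sup>2) + real (n * (n - 1)) * - ln \<rho>
      + (\<Sum>k<n. \<Sum>j\<in>{..<n} - {k}. - ln (cmod (\<alpha> k - \<alpha> j)))"
proof -
  define w where "w k = of_real \<rho> * \<alpha> k" for k
  have w_le: "cmod (w k) \<le> \<rho>" if "k < n" for k
    using disk[OF that] \<rho> by (simp add: w_def norm_mult mult_left_le)
  hence w: "cmod (w k) < 1" if "k < n" for k using that \<rho> by fastforce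
  have diagonal: "- ln (cmod (1 - w j * cnj (w j))) \<le> - ln (1 - \<rho>\<^sup>2)" if "j < n" for j
  proof -
    have sq: "cmod (w j) ^ 2 \<le> \<rho>\<^sup>2" using w_le[OF that] by (intro power_mono) auto
    have "\<rho>\<^sup>2 < 1" using \<rho> by (simp add: power_less_one_iff)
    have "1 - w j * cnj (w j) = of_real (1 - cmod (w j) ^ 2)"
      by (simp only: complex_norm_square of_real_diff of_real_1)
    hence "cmod (1 - w j * cnj (w j)) = \<bar>1 - cmod (w j) ^ 2\<bar>" by (simp only: norm_of_real)
    thus ?thesis using sq \<open>\<rho>\<^sup>2 < 1\<close> by simp
  qed
  have off: "- ln (cmod (1 - w j * cnj (w k))) \<le> - ln \<rho> + - ln (cmod (\<alpha> j - \<alpha> k))"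
    if "j < n" "k < n" "k \<noteq> j" for j k
  proof -
    have pos: "0 < cmod (\<alpha> j - \<alpha> k)" using that inj by (auto simp: inj_on_def)
    have "\<rho> * cmod (\<alpha> j - \<alpha> k) = cmod (w j - w k)"
      using \<rho> by (simp add: w_def right_diff_distrib[symmetric] norm_mult)
    also have "\<dots> \<le> cmod (1 - w j * cnj (w k))"
      using w[OF that(1)] w[OF that(2)] by (intro cmod_diff_le_cmod_one_minus_cnj) auto
    finally have "ln (\<rho> * cmod (\<alpha> j - \<alpha> k)) \<le> ln (cmod (1 - w j * cnj (w k)))"
      using \<rho> pos by (intro ln_mono) auto
    thus ?thesis using \<rho> pos by (simp add: ln_mult)
  qed
  have "(\<Sum>k<n. w k ^ m) = of_real (\<rho> ^ m) * (\<Sum>k<n. \<alpha> k ^ m)"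
    by (simp add: w_def power_mult_distrib sum_distrib_left)
  hence "cmod (\<Sum>k<n. w k ^ m) = \<rho> ^ m * cmod (\<Sum>k<n. \<alpha> k ^ m)"
    using \<rho> by (simp only: norm_mult norm_of_real) simp
  hence "\<rho> ^ (2 * m) * cmod (\<Sum>k<n. \<alpha> k ^ m) ^ 2 / real m = cmod (\<Sum>k<n. w k ^ m) ^ 2 / real m"
    by (simp add: power_mult_distrib power_mult[symmetric] mult.commute)
  also have "\<dots> \<le> (\<Sum>j<n. \<Sum>k<n. - ln (cmod (1 - w j * cnj (w k))))"
    by (rule power_sum_le_logarithmic_energy) (use w in auto)
  also have "\<dots> \<le> (\<Sum>j<n. - ln (1 - \<rho>\<^sup>2) + (\<Sum>k\<in>{..<n} - {j}. - ln \<rho> + - ln (cmod (\<alpha> j - \<alpha> k))))"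
  proof (rule sum_mono)
    fix j assume "j \<in> {..<n}"
    hence "j < n" by simp
    have "(\<Sum>k<n. - ln (cmod (1 - w j * cnj (w k)))) = - ln (cmod (1 - w j * cnj (w j)))
        + (\<Sum>k\<in>{..<n} - {j}. - ln (cmod (1 - w j * cnj (w k))))"
      using \<open>j < n\<close> by (intro sum.remove) auto
    also have "\<dots> \<le> - ln (1 - \<rho>\<^sup>2) + (\<Sum>k\<in>{..<n} - {j}. - ln \<rho> + - ln (cmod (\<alpha> j - \<alpha> k)))"
      by (intro add_mono sum_mono diagonal off) (use \<open>j < n\<close> in auto)
    finally show "(\<Sum>k<n. - ln (cmod (1 - w j * cnj (w k))))
        \<le> - ln (1 - \<rho>\<^sup>2) + (\<Sum>k\<in>{..<n} - {j}. - ln \<rho> + - ln (cmod (\<alpha> j - \<alpha> k)))" .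
  qed
  also have "\<dots> = real n * - ln (1 - \<rho>\<^sup>2) + real (n * (n - 1)) * - ln \<rho>
      + (\<Sum>k<n. \<Sum>j\<in>{..<n} - {k}. - ln (cmod (\<alpha> k - \<alpha> j)))"
  proof -
    have "(\<Sum>k\<in>{..<n} - {j}. - ln \<rho> + - ln (cmod (\<alpha> j - \<alpha> k)))
        = real (n - 1) * - ln \<rho> + (\<Sum>k\<in>{..<n} - {j}. - ln (cmod (\<alpha> j - \<alpha> k)))" if "j \<in> {..<n}" for j
    proof -
      have "card ({..<n} - {j}) = n - 1" using that by simp
      thus ?thesis by (simp only: sum.distrib sum_constant)
    qed
    thus ?thesis
      by (simp only: sum.distrib sum_constant card_lessThan of_nat_mult mult.assoc add.assoc cong: sum.cong)
  qed
  finally show ?thesis .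
qed

text \<open>
  The contraction factor balances three demands. For \<open>\<rho>\<^sup>2 = 1 - x\<close> with \<open>x = 1/(mn)\<close>, the weight
  \<open>\<rho>\<^sup>2\<^sup>m = (1 - x)\<^sup>m \<ge> 1 - 1/n\<close> stays bounded below, the diagonal terms are \<open>ln (mn)\<close> each, and the
  off-diagonal cost \<open>- ln \<rho> \<le> x\<close> adds up to less than \<open>n\<close>.
\<close>

lemma power_sum_sq_le:
  fixes \<alpha> :: "nat \<Rightarrow> complex"
  assumes disk: "\<And>k. k < n \<Longrightarrow> cmod (\<alpha> k) \<le> 1" and inj: "inj_on \<alpha> {..<n}"
    and sep: "(\<Sum>k<n. \<Sum>j\<in>{..<n} - {k}. - ln (cmod (\<alpha> k - \<alpha> j))) \<le> C * (real n * ln (real n))"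
    and n: "n \<ge> 3" and m: "m \<ge> 1"
  shows "cmod (\<Sum>k<n. \<alpha> k ^ m) ^ 2 \<le> 2 * real m * (real m + 1 + C) * (real n * ln (real n))"
proof -
  define l where "l = ln (real n)"
  \<comment> \<open>\<open>n \<ge> 3 \<ge> e\<close>, so that lower-order terms can be absorbed into multiples of \<open>ln n\<close>.\<close>
  have l: "1 \<le> l"
    using n exp_le by (auto simp: l_def ln_ge_iff intro: order_trans)
  define x where "x = 1 / (real m * real n)"
  have mn: "3 \<le> real m * real n" using mult_mono[of 1 "real m" 3 "real n"] m n by simp
  have x: "0 < x" "x \<le> 1 / 3" "real m * x = 1 / real n" "real n * x \<le> 1"
    using mn m n by (auto simp: x_def field_simps)
  define \<rho> where "\<rho> = sqrt (1 - x)"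
  have \<rho>: "0 < \<rho>" "\<rho> < 1" "\<rho>\<^sup>2 = 1 - x" using x by (auto simp: \<rho>_def)
  have weight: "1 / 2 \<le> \<rho> ^ (2 * m)"
  proof -
    have "1 + real m * - x \<le> (1 + - x) ^ m"
      using x by (intro Bernoulli_inequality) auto
    moreover have "1 / real n \<le> 1 / 2" using n by (simp add: field_simps)
    ultimately show ?thesis using x(3) \<rho>(3) by (simp add: power_mult)
  qed
  have "- ln \<rho> \<le> x"
  proof -
    have "- x - 2 * x\<^sup>2 \<le> ln (1 - x)" using x by (intro ln_one_minus_pos_lower_bound) auto
    moreover have "2 * x\<^sup>2 \<le> x" using x by (simp add: power2_eq_square)
    ultimately show ?thesis using x by (simp add: \<rho>_def ln_sqrt)
  qed
  hence "real (n * (n - 1)) * - ln \<rho> \<le> real (n * (n - 1)) * x"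
    by (intro mult_left_mono) auto
  also have "\<dots> = real (n - 1) * (real n * x)" by simp
  also have "\<dots> \<le> real (n - 1) * 1" using x by (intro mult_left_mono) auto
  also have "\<dots> \<le> real n * 1" by simp
  also have "\<dots> \<le> real n * l" using l by (intro mult_left_mono) auto
  finally have off: "real (n * (n - 1)) * - ln \<rho> \<le> real n * l" .
  have "- ln (1 - \<rho>\<^sup>2) = ln (real m) + l"
    using m n by (simp add: \<rho>(3) x_def ln_div ln_mult l_def)
  also have "\<dots> \<le> (real m - 1) * l + l"
  proof -
    \<comment> \<open>This crude bound makes the estimate of the square quadratic in \<open>m\<close>: linear for the power sum.\<close>
    have "ln (real m) \<le> (real m - 1) * 1" using m ln_le_minus_one[of "real m"] by simp
    also have "\<dots> \<le> (real m - 1) * l" using m l by (intro mult_left_mono) auto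
    finally show ?thesis by simp
  qed
  finally have "- ln (1 - \<rho>\<^sup>2) \<le> real m * l" by (simp add: algebra_simps)
  hence diag: "real n * - ln (1 - \<rho>\<^sup>2) \<le> real n * (real m * l)"
    by (intro mult_left_mono) auto
  define s where "s = cmod (\<Sum>k<n. \<alpha> k ^ m) ^ 2"
  have "1 / 2 * s / real m \<le> \<rho> ^ (2 * m) * s / real m"
    using weight m by (intro divide_right_mono mult_right_mono) (auto simp: s_def)
  also have "\<dots> \<le> real n * (real m * l) + real n * l + C * (real n * l)"
    using power_sum_le_separation[OF disk inj \<rho>(1,2), of m] diag off sep
    unfolding s_def l_def by linarith
  also have "\<dots> = (real m + 1 + C) * (real n * l)" by (simp add: algebra_simps)
  finally have "s \<le> 2 * real m * ((real m + 1 + C) * (real n * l))"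
    using m by (simp add: field_simps)
  thus ?thesis by (simp add: s_def l_def mult.assoc)
qed

section \<open>The bound for integer polynomials\<close>

lemma inj_on_roots_of_simple:
  fixes \<alpha> :: "'b \<Rightarrow> 'a::idom"
  assumes fin: "finite I" and p: "p = smult c (\<Prod>k\<in>I. [:- \<alpha> k, 1:])" "p \<noteq> 0"
    and simple: "\<And>z. poly p z = 0 \<Longrightarrow> order z p = 1"
  shows "inj_on \<alpha> I"
proof (rule inj_onI, rule ccontr)
  fix i j assume ij: "i \<in> I" "j \<in> I" "\<alpha> i = \<alpha> j" "i \<noteq> j"
  have "(\<Prod>k\<in>{i, j}. [:- \<alpha> k, 1:]) dvd (\<Prod>k\<in>I. [:- \<alpha> k, 1:])"
    using ij fin by (intro prod_dvd_prod_subset) auto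
  moreover have "(\<Prod>k\<in>{i, j}. [:- \<alpha> k, 1:]) = [:- \<alpha> i, 1:] ^ 2"
    using ij by (simp add: power2_eq_square)
  ultimately have sq: "[:- \<alpha> i, 1:] ^ 2 dvd p" unfolding p(1) by (metis dvd_smult)
  hence "2 \<le> order (\<alpha> i) p" using p(2) by (simp add: order_divides)
  moreover from this have "poly p (\<alpha> i) = 0" using p(2) by (simp add: order_root)
  ultimately show False using simple[of "\<alpha> i"] by simp
qed

theorem theorem2p6:
  fixes M :: real and m n :: nat and P :: "int poly" and \<alpha> :: "nat \<Rightarrow> complex"
  assumes "M > 0" and "m \<ge> 1" and "n \<ge> 1"
    and "P \<in> int_polys_simple n closed_unit_disk M"
    and "map_poly of_int P = smult (of_int (lead_coeff P)) (\<Prod>k=1..n. [:- \<alpha> k, 1:])"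
    and "real n \<ge> max M 55"
  shows "cmod (\<Sum>k=1..n. \<alpha> k ^ m) \<le> (24 * real m + 16) * sqrt (real n * ln (real n))"
proof -
  \<comment> \<open>Indices starting from \<open>0\<close>, as the matrix rows and columns do.\<close>
  define \<beta> where "\<beta> k = \<alpha> (Suc k)" for k
  define a where "a = lead_coeff P"
  define p where "p = map_poly complex_of_int P"
  have P: "P \<noteq> 0" "degree P \<le> n" "\<bar>real_of_int a\<bar> \<le> M"
    using assms(4) by (auto simp: int_polys_simple_def a_def)
  have roots: "z \<in> closed_unit_disk \<and> order z p = 1" if "poly p z = 0" for z
    using assms(4) that by (auto simp: int_polys_simple_def p_def)
  have a: "a \<noteq> 0" using P by (simp add: a_def)
  have fact: "p = smult (of_int a) (\<Prod>k<n. [:- \<beta> k, 1:])"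
    using assms(5) by (simp add: p_def a_def \<beta>_def prod.atLeast1_atMost_eq)
  have "p \<noteq> 0" unfolding fact using a by simp
  hence inj: "inj_on \<beta> {..<n}"
    using fact roots by (intro inj_on_roots_of_simple[where p = p and c = "of_int a"]) auto
  have disk: "cmod (\<beta> k) \<le> 1" if "k < n" for k
    using roots[of "\<beta> k"] that by (auto simp: fact poly_prod)
  have "ln \<bar>real_of_int a\<bar> \<le> ln (real n)"
    using a P(3) assms(6) by (intro ln_mono) auto
  hence "real (2 * n - 1) * ln \<bar>real_of_int a\<bar> \<le> (2 * real n) * ln (real n)"
    using a assms(6) by (intro mult_mono) auto
  hence "(\<Sum>k<n. \<Sum>j\<in>{..<n} - {k}. - ln (cmod (\<beta> k - \<beta> j))) \<le> 2 * (real n * ln (real n))"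
    using root_separation_sum_le[OF fact[unfolded p_def] a P(2) inj] by simp
  hence "cmod (\<Sum>k<n. \<beta> k ^ m) ^ 2 \<le> 2 * real m * (real m + 1 + 2) * (real n * ln (real n))"
    using assms by (intro power_sum_sq_le disk inj) auto
  also have "\<dots> \<le> (24 * real m + 16)\<^sup>2 * (real n * ln (real n))"
  proof (rule mult_right_mono)
    show "2 * real m * (real m + 1 + 2) \<le> (24 * real m + 16)\<^sup>2"
      by (simp add: power2_eq_square algebra_simps add_increasing)
  qed (use assms in auto)
  also have "\<dots> = ((24 * real m + 16) * sqrt (real n * ln (real n)))\<^sup>2"
    using assms by (simp add: power_mult_distrib)
  finally have "cmod (\<Sum>k<n. \<beta> k ^ m) \<le> (24 * real m + 16) * sqrt (real n * ln (real n))"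
    by (rule power2_le_imp_le) (use assms in auto)
  thus ?thesis by (simp add: \<beta>_def sum.atLeast1_atMost_eq)
qed

end
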